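(* Let $s\ge1$ and let $A:\mathbb N\to\mathbb C^{s\times s}$ be a matrix sequence. Then $A$ is convolutionally invertible if and only if $A(0)$ is nonsingular. Moreover, when $A(0)$ is nonsingular, let $D$ be the sequence concentrated at zero with $D(0)=A(0)^{-1}$ (so $D(k)$ is the zero matrix for $k\ge1$) and set $\widetilde A=A*D$. Then $$A^{(-1)}=D*\sum_{n\ge0}(e_0-\widetilde A)^{(n)}.$$ For every $k\in\mathbb N$, the sum evaluated at $k$ is finite (only finitely many terms are nonzero) and $$A^{(-1)}(k)=A(0)^{-1}\sum_{n=0}^{k}(e_0-\widetilde A)^{(n)}(k).$$
   Context: $\mathbb N=\{0,1,2,\ldots\}$. For sequences $A,B:\mathbb N\to\mathbb C^{s\times s}$ the convolution is $(A*B)(k)=\sum_{\ell=0}^kA(\ell)B(k-\ell)$. The identity is $e_0$, with $e_0(0)=I_s$ and $e_0(k)=O_s$ (zero matrix) for $k\ge1$. The $n$-fold convolution power of $A$ is $A^{(n)}$, with $A^{(0)}=e_0$. A sequence $A$ is convolutionally invertible if there is a sequence $A^{(-1)}:\mathbb N\to\mathbb C^{s\times s}$ with $A*A^{(-1)}=e_0=A^{(-1)}*A$. Infinite sums of sequences are taken coefficientwise. *)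

theory Defs
  imports "HOL-Analysis.Analysis"
begin

type_synonym 's matseq = "nat \<Rightarrow> complex ^ 's ^ 's"

definition conv :: "'s::finite matseq \<Rightarrow> 's matseq \<Rightarrow> 's matseq"  (infixl \<open>\<star>\<close> 70)
  where "A \<star> B = (\<lambda>k. \<Sum>l=0..k. A l ** B (k - l))"

definition at_zero :: "complex ^ 's ^ 's \<Rightarrow> 's::finite matseq"
  where "at_zero M = (\<lambda>k. if k = 0 then M else 0)"

definition e0 :: "'s::finite matseq"
  where "e0 = at_zero (mat 1)"

primrec conv_pow :: "'s::finite matseq \<Rightarrow> nat \<Rightarrow> 's matseq"
  where
    "conv_pow A 0 = e0"
  | "conv_pow A (Suc n) = A \<star> conv_pow A n"

definition conv_inverse_of :: "'s::finite matseq \<Rightarrow> 's matseq \<Rightarrow> bool"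
  where "conv_inverse_of A B \<longleftrightarrow> A \<star> B = e0 \<and> B \<star> A = e0"

definition conv_invertible :: "'s::finite matseq \<Rightarrow> bool"
  where "conv_invertible A \<longleftrightarrow> (\<exists>B. conv_inverse_of A B)"

text \<open>Meaningful only if \<open>A\<close> is convolutionally invertible; the description is then
  proper by the uniqueness lemma \<open>conv_inverse_unique\<close> below.\<close>

definition conv_inv :: "'s::finite matseq \<Rightarrow> 's matseq"
  where "conv_inv A = (THE B. conv_inverse_of A B)"

text \<open>Coefficientwise infinite sum. The value of \<open>suminf\<close> is unspecified for a divergent
  series; it is the finite sum whenever only finitely many terms \<open>X n k\<close> are nonzero.\<close>

definition seq_series :: "(nat \<Rightarrow> 's::finite matseq) \<Rightarrow> 's matseq"
  where "seq_series X = (\<lambda>k. \<Sum>n. X n k)"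

lemma matrix_add_rdistrib_sq: "(B + C) ** M = B ** M + C ** M"
  for M :: "complex ^ 's::finite ^ 's"
  by (simp add: vec_eq_iff matrix_matrix_mult_def sum.distrib distrib_right)

lemma matrix_mult_sum_left: "(\<Sum>i\<in>I. f i) ** M = (\<Sum>i\<in>I. f i ** M)"
  for M :: "complex ^ 's::finite ^ 's"
  by (induction I rule: infinite_finite_induct) (auto simp: matrix_add_rdistrib_sq)

lemma matrix_mult_sum_right: "M ** (\<Sum>i\<in>I. f i) = (\<Sum>i\<in>I. M ** f i)"
  for M :: "complex ^ 's::finite ^ 's"
  by (induction I rule: infinite_finite_induct) (auto simp: matrix_add_ldistrib)

lemma conv_assoc: "(A \<star> B) \<star> C = A \<star> (B \<star> C)"
proof
  fix n
  have "(\<Sum>j=0..n. \<Sum>i=0..j. A i ** B (j - i) ** C (n - j)) =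
        (\<Sum>j=0..n. \<Sum>i=0..n - j. A j ** B i ** C (n - j - i))"
    by (rule fps_mult_assoc_lemma)
  then show "((A \<star> B) \<star> C) n = (A \<star> (B \<star> C)) n"
    by (simp add: conv_def matrix_mult_sum_left matrix_mult_sum_right matrix_mul_assoc)
qed

lemma conv_e0_left: "e0 \<star> A = A"
proof
  fix k
  have "(e0 \<star> A) k = (\<Sum>l=0..k. if l = 0 then A k else 0)"
    unfolding conv_def e0_def at_zero_def by (intro sum.cong) auto
  then show "(e0 \<star> A) k = A k" by simp
qed

lemma conv_e0_right: "A \<star> e0 = A"
proof
  fix k
  have "(A \<star> e0) k = (\<Sum>l=0..k. if l = k then A k else 0)"
    unfolding conv_def e0_def at_zero_def by (intro sum.cong) auto
  then show "(A \<star> e0) k = A k" by simp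
qed

lemma conv_inverse_unique:
  assumes "conv_inverse_of A B" "conv_inverse_of A C"
  shows "B = C"
  using assms unfolding conv_inverse_of_def
  by (metis conv_assoc conv_e0_left conv_e0_right)

lemma conv_inv_eqI: "conv_inverse_of A B \<Longrightarrow> conv_inv A = B"
  unfolding conv_inv_def by (blast intro: conv_inverse_unique)

lemma seq_series_finite:
  assumes "finite {n. X n k \<noteq> 0}"
  shows "seq_series X k = (\<Sum>n\<in>{n. X n k \<noteq> 0}. X n k)"
  unfolding seq_series_def by (rule suminf_finite) (use assms in auto)

end

theory Submission
  imports Defs
begin

text \<open>Since \<open>A \<star> D\<close> has constant coefficient \<open>I\<close>, the sequence \<open>U = e0 - A \<star> D\<close> vanishes at
  \<open>0\<close>, so its \<open>n\<close>-th power vanishes below \<open>n\<close> and the geometric series of \<open>U\<close> is coefficientwise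
  finite. It inverts \<open>e0 - U = A \<star> D\<close>, and composing with the invertible sequence \<open>D\<close> inverts \<open>A\<close>.\<close>

lemma matseq_diff_diff: "A - (A - B) = B"
  for A B :: "'s::finite matseq"
  by (rule ext) simp

lemma conv_at_0: "(A \<star> B) 0 = A 0 ** B 0"
  by (simp add: conv_def)

lemma conv_diff_left: "(A - B) \<star> C = A \<star> C - B \<star> C"
  by (rule ext) (simp add: conv_def vec_eq_iff matrix_matrix_mult_def left_diff_distrib sum_subtractf)

lemma conv_diff_right: "C \<star> (A - B) = C \<star> A - C \<star> B"
  by (rule ext) (simp add: conv_def vec_eq_iff matrix_matrix_mult_def right_diff_distrib sum_subtractf)

lemma conv_at_zero_left: "(at_zero M \<star> A) k = M ** A k"
proof -
  have "(at_zero M \<star> A) k = (\<Sum>l=0..k. if l = 0 then M ** A k else 0)"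
    unfolding conv_def at_zero_def by (intro sum.cong) auto
  then show ?thesis by simp
qed

lemma conv_at_zero_at_zero: "at_zero M \<star> at_zero N = at_zero (M ** N)"
  by (rule ext) (simp add: conv_at_zero_left, simp add: at_zero_def)

lemma conv_inverse_of_at_zero:
  assumes "M ** N = mat 1" "N ** M = mat 1"
  shows "conv_inverse_of (at_zero M) (at_zero N)"
  by (simp add: conv_inverse_of_def conv_at_zero_at_zero assms e0_def)

text \<open>Convolution of matrix sequences does not commute, so the recursion, which multiplies on
  the left, has to be turned around before \<open>U\<close> can act on the series from the
  right.\<close>

lemma conv_pow_Suc_right: "conv_pow U (Suc n) = conv_pow U n \<star> U"
proof (induction n)
  case 0
  show ?case by (simp add: conv_e0_left conv_e0_right)
next
  case (Suc n)
  then show ?case by (metis conv_assoc conv_pow.simps(2))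
qed

text \<open>In the coefficient of \<open>U \<star> conv_pow U n\<close> at \<open>k\<close>, the
  term \<open>l = 0\<close> dies with \<open>U 0\<close>; every other term has
  \<open>k - l < n\<close> and dies by induction.\<close>

lemma conv_pow_eq_0:
  assumes "U 0 = 0" "k < n"
  shows "conv_pow U n k = 0"
  using assms(2)
proof (induction n arbitrary: k)
  case (Suc n)
  have "U l ** conv_pow U n (k - l) = 0" if "l \<le> k" for l
  proof (cases "l = 0")
    case False
    then have "k - l < n" using that Suc.prems by simp
    then show ?thesis using Suc.IH by simp
  qed (simp add: assms(1))
  then show ?case by (simp add: conv_def)
qed simp

lemma finite_conv_pow_nonzero:
  assumes "U 0 = 0"
  shows "finite {n. conv_pow U n k \<noteq> 0}"
proof (rule finite_subset)
  show "{n. conv_pow U n k \<noteq> 0} \<subseteq> {..k}"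
    using conv_pow_eq_0[where U = U, OF assms] by (force simp: not_less[symmetric])
qed simp

text \<open>The bound \<open>N\<close> is kept free so that a single truncation represents all
  coefficients up to \<open>N\<close> at once.\<close>

lemma seq_series_conv_pow:
  assumes "U 0 = 0" "k \<le> N"
  shows "seq_series (conv_pow U) k = (\<Sum>n=0..N. conv_pow U n k)"
proof -
  have "{n. conv_pow U n k \<noteq> 0} \<subseteq> {0..N}"
    using conv_pow_eq_0[where U = U, OF assms(1)] assms(2) by (fastforce simp: not_less[symmetric])
  then show ?thesis
    unfolding seq_series_finite[of "conv_pow U", OF finite_conv_pow_nonzero[where U = U, OF assms(1)]]
    by (intro sum.mono_neutral_left) auto
qed

lemma conv_sum_right: "(A \<star> (\<lambda>j. \<Sum>i\<in>I. F i j)) k = (\<Sum>i\<in>I. (A \<star> F i) k)"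
  unfolding conv_def matrix_mult_sum_right by (rule sum.swap)

lemma conv_sum_left: "((\<lambda>j. \<Sum>i\<in>I. F i j) \<star> A) k = (\<Sum>i\<in>I. (F i \<star> A) k)"
  unfolding conv_def matrix_mult_sum_left by (rule sum.swap)

text \<open>This allows the series to be replaced by a finite sum inside a convolution, as only
  entries up to \<open>k\<close> enter the coefficient at \<open>k\<close>.\<close>

lemma conv_cong_upto:
  assumes "\<And>j. j \<le> k \<Longrightarrow> A j = A' j" "\<And>j. j \<le> k \<Longrightarrow> B j = B' j"
  shows "(A \<star> B) k = (A' \<star> B') k"
  unfolding conv_def using assms by (intro sum.cong) auto

text \<open>Writing \<open>S\<close> for the series, multiplication by \<open>U\<close> on either
  side shifts the powers by one and yields \<open>S - e0\<close>. Hence both products of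
  \<open>e0 - U\<close> with \<open>S\<close> equal \<open>S - (S - e0) = e0\<close>.\<close>

lemma conv_inverse_of_geometric:
  assumes U0: "U 0 = 0"
  shows "conv_inverse_of (e0 - U) (seq_series (conv_pow U))"
proof -
  let ?S = "seq_series (conv_pow U)"
  have telescope: "(\<Sum>n=0..k. conv_pow U (Suc n) k) = ?S k - e0 k" for k
  proof -
    \<comment> \<open>Truncating one term later than necessary adds only a zero, and after splitting
      off \<open>n = 0\<close> the shifted sum again runs over \<open>0..k\<close>.\<close>
    have "?S k = (\<Sum>n=0..Suc k. conv_pow U n k)"
      by (rule seq_series_conv_pow[where U = U, OF U0]) simp
    also have "\<dots> = e0 k + (\<Sum>n=0..k. conv_pow U (Suc n) k)"
      by (subst sum.atLeast0_atMost_Suc_shift) simp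
    finally show ?thesis by simp
  qed
  have "(U \<star> ?S) k = ?S k - e0 k" for k
  proof -
    have "(U \<star> ?S) k = (U \<star> (\<lambda>j. \<Sum>n=0..k. conv_pow U n j)) k"
      by (intro conv_cong_upto seq_series_conv_pow[where U = U, OF U0]) simp_all
    then show ?thesis
      using telescope[of k] by (simp add: conv_sum_right)
  qed
  then have left: "U \<star> ?S = ?S - e0" by (intro ext) simp
  have "(?S \<star> U) k = ?S k - e0 k" for k
  proof -
    have "(?S \<star> U) k = ((\<lambda>j. \<Sum>n=0..k. conv_pow U n j) \<star> U) k"
      by (intro conv_cong_upto seq_series_conv_pow[where U = U, OF U0]) simp_all
    then show ?thesis
      using telescope[of k]
      by (simp add: conv_sum_left conv_pow_Suc_right del: conv_pow.simps(2))
  qed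
  then have right: "?S \<star> U = ?S - e0" by (intro ext) simp
  show ?thesis
    by (simp add: conv_inverse_of_def conv_diff_left conv_diff_right conv_e0_left conv_e0_right
        left right matseq_diff_diff)
qed

text \<open>On the right, associativity suffices. On the left, \<open>A\<close> is written as
  \<open>(A \<star> D) \<star> E\<close>, so that \<open>S\<close> cancels
  \<open>A \<star> D\<close> and then \<open>D\<close> cancels \<open>E\<close>.\<close>

lemma conv_inverse_of_conv_right:
  assumes AD: "conv_inverse_of (A \<star> D) S" and D: "conv_inverse_of D E"
  shows "conv_inverse_of A (D \<star> S)"
proof -
  have A: "A = (A \<star> D) \<star> E"
    using D by (simp add: conv_inverse_of_def conv_assoc conv_e0_right)
  have "(D \<star> S) \<star> A = D \<star> ((S \<star> (A \<star> D)) \<star> E)"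
    by (subst A) (simp only: conv_assoc)
  also have "\<dots> = e0"
    using AD D by (simp add: conv_inverse_of_def conv_e0_left)
  finally show ?thesis
    using AD by (simp add: conv_inverse_of_def conv_assoc)
qed

text \<open>Evaluation at \<open>0\<close> turns convolution into the matrix product, so
  \<open>B 0\<close> is a two-sided inverse of \<open>A 0\<close>.\<close>

lemma conv_inverse_of_imp_invertible:
  assumes "conv_inverse_of A B"
  shows "invertible (A 0)"
proof -
  have "(A \<star> B) 0 = e0 0" "(B \<star> A) 0 = e0 0"
    using assms by (simp_all add: conv_inverse_of_def)
  then show ?thesis
    by (auto simp: conv_at_0 e0_def at_zero_def invertible_def)
qed

text \<open>\<open>matrix_inv\<close> chooses a two-sided inverse, and \<open>invertible\<close>
  says that there is one to choose.\<close>

lemma matrix_inv_mult: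
  assumes "invertible M"
  shows "M ** matrix_inv M = mat 1" "matrix_inv M ** M = mat 1"
  using someI_ex[OF assms[unfolded invertible_def]] by (simp_all add: matrix_inv_def)

lemma conv_inverse_of_neumann:
  assumes "invertible (A 0)" and D: "D = at_zero (matrix_inv (A 0))"
  shows "conv_inverse_of A (D \<star> seq_series (conv_pow (e0 - A \<star> D)))"
    and "(e0 - A \<star> D) 0 = 0"
proof -
  note inv = matrix_inv_mult[OF assms(1)]
  show U0: "(e0 - A \<star> D) 0 = 0"
    by (simp add: conv_at_0 D e0_def at_zero_def inv)
  \<comment> \<open>The geometric series of \<open>U = e0 - A \<star> D\<close> inverts
    \<open>e0 - U\<close>, which is \<open>A \<star> D\<close> again.\<close>
  have "conv_inverse_of (A \<star> D) (seq_series (conv_pow (e0 - A \<star> D)))"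
    using conv_inverse_of_geometric[where U = "e0 - A \<star> D", OF U0]
    by (simp add: matseq_diff_diff)
  moreover have "conv_inverse_of D (at_zero (A 0))"
    unfolding D by (rule conv_inverse_of_at_zero) (fact inv)+
  ultimately show "conv_inverse_of A (D \<star> seq_series (conv_pow (e0 - A \<star> D)))"
    by (rule conv_inverse_of_conv_right)
qed

theorem theorem2p2:
  fixes A :: "'s::finite matseq"
  shows "(conv_invertible A \<longleftrightarrow> invertible (A 0)) \<and>
    (invertible (A 0) \<longrightarrow>
      (let D = at_zero (matrix_inv (A 0)); A' = A \<star> D in
        conv_inv A = D \<star> seq_series (\<lambda>n. conv_pow (e0 - A') n) \<and>
        (\<forall>k. finite {n. conv_pow (e0 - A') n k \<noteq> 0} \<and>
             conv_inv A k = matrix_inv (A 0) ** (\<Sum>n=0..k. conv_pow (e0 - A') n k))))"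
proof -
  define D where "D = at_zero (matrix_inv (A 0))"
  let ?U = "e0 - A \<star> D"
  have invertible: "conv_invertible A \<longleftrightarrow> invertible (A 0)"
    using conv_inverse_of_imp_invertible conv_inverse_of_neumann(1)
    unfolding conv_invertible_def by blast
  have "conv_inv A = D \<star> seq_series (conv_pow ?U) \<and>
      (\<forall>k. finite {n. conv_pow ?U n k \<noteq> 0} \<and>
           conv_inv A k = matrix_inv (A 0) ** (\<Sum>n=0..k. conv_pow ?U n k))"
    if inv: "invertible (A 0)"
  proof (intro conjI allI)
    note U0 = conv_inverse_of_neumann(2)[where A = A, OF inv D_def]
    show eq: "conv_inv A = D \<star> seq_series (conv_pow ?U)"
      by (rule conv_inv_eqI[OF conv_inverse_of_neumann(1)[where A = A, OF inv D_def]])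
    show "finite {n. conv_pow ?U n k \<noteq> 0}" for k
      by (rule finite_conv_pow_nonzero[where U = ?U, OF U0])
    show "conv_inv A k = matrix_inv (A 0) ** (\<Sum>n=0..k. conv_pow ?U n k)" for k
      \<comment> \<open>Truncation is taken at \<open>N = k\<close>; convolving with
        \<open>D\<close> on the left multiplies each coefficient by
        \<open>matrix_inv (A 0)\<close>.\<close>
      using seq_series_conv_pow[where U = ?U, OF U0 order_refl, of k]
      by (simp only: eq) (simp add: D_def conv_at_zero_left)
  qed
  with invertible show ?thesis
    unfolding Let_def D_def by blast
qed

end
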